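(* Let $\alpha\in(0,1)$ and $\theta\in(-\alpha,\infty)$ be fixed, and let $K=K_{n,\theta,\alpha}$ be the length of a Pitman partition of $n$ with parameters $(\theta,\alpha)$. For every $r=1,2,\ldots$, as $n\to\infty$, $$ \mathsf{E}\left[\left(\frac{K}{n^\alpha}\right)^r\right] =\left(1+\frac{\theta}{\alpha}\right)_{r}\frac{\Gamma(\theta+1)}{\Gamma(\theta+r\alpha+1)}\left[1-\left\{\frac{r(r-1)\alpha}{2}+r\theta\right\}\frac{\Gamma(\theta+r\alpha)}{\Gamma(\theta+(r-1)\alpha+1)}\frac{1}{n^\alpha}\right]+O\left(\frac{1}{n^{2\alpha}}+\frac{1}{n}\right). $$
   Context: For real $x$ and $y\ge 0$, put $(x)_{0;y}=1$ and $(x)_{i;y}=x(x+y)(x+2y)\cdots(x+(i-1)y)$ for $i=1,2,\ldots$; write $(x)_i=(x)_{i;1}$ (rising factorial). $\Gamma$ is the Gamma function. For a positive integer $n$, let $\mathcal{P}_n=\{(c_1,\ldots,c_n)\in(\mathbb{N}\cup\{0\})^n:\sum_{i=1}^n i c_i=n\}$ (component counts of integer partitions of $n$). For $\alpha\in(0,1)$ and $\theta>-\alpha$, a $\mathcal{P}_n$-valued random variable $\mathbf{C}=(C_1^{n,\theta,\alpha},\ldots,C_n^{n,\theta,\alpha})$ is the vector of component counts of a Pitman partition (follows the Pitman sampling formula) if $$\mathsf{P}(\mathbf{C}=(c_1,\ldots,c_n))=n!\,\frac{(\theta)_{k;\alpha}}{(\theta)_n}\prod_{i=1}^n\left(\frac{(1-\alpha)_{i-1}}{i!}\right)^{c_i}\frac{1}{c_i!},\qquad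 (c_1,\ldots,c_n)\in\mathcal{P}_n,\quad k=\sum_{i=1}^n c_i.$$ When $\theta=0$ the ratio $(\theta)_{k;\alpha}/(\theta)_n$ is understood with the common factor $\theta$ cancelled, i.e. as $(\theta+\alpha)_{k-1;\alpha}/(\theta+1)_{n-1}$. The length of the Pitman partition is $K=K_{n,\theta,\alpha}=\sum_{i=1}^n C_i^{n,\theta,\alpha}$. The implied constant in $O(\cdot)$ may depend on $r,\theta,\alpha$. *)

theory Defs
  imports "HOL-Probability.Probability" "HOL-Library.Landau_Symbols"
begin

definition rising_step :: "real \<Rightarrow> real \<Rightarrow> nat \<Rightarrow> real" where
  "rising_step x y i = (\<Prod>j<i. x + real j * y)"

lemma rising_step_1: "rising_step x 1 i = pochhammer x i"
  by (simp add: rising_step_def pochhammer_prod lessThan_atLeast0)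

text \<open>A vector of component counts \<open>(c\<^sub>1, \<dots>, c\<^sub>n)\<close> is encoded as a function on the natural numbers
  that vanishes outside \<open>{1..n}\<close>, so that every vector has exactly one representative.\<close>

definition partition_counts :: "nat \<Rightarrow> (nat \<Rightarrow> nat) set" where
  "partition_counts n = {c. (\<forall>i. i \<notin> {1..n} \<longrightarrow> c i = 0) \<and> (\<Sum>i=1..n. i * c i) = n}"

definition partition_length :: "nat \<Rightarrow> (nat \<Rightarrow> nat) \<Rightarrow> nat" where
  "partition_length n c = (\<Sum>i=1..n. c i)"

text \<open>The ratio \<open>(\<theta>)\<^sub>k\<^sub>;\<^sub>\<alpha> / (\<theta>)\<^sub>n\<close>, where for \<open>\<theta> = 0\<close> the common factor \<open>\<theta>\<close> is cancelled.
  It is used only for \<open>k \<ge> 1\<close> and \<open>n \<ge> 1\<close>, so the natural-number subtractions are genuine.\<close>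

definition pitman_ratio :: "real \<Rightarrow> real \<Rightarrow> nat \<Rightarrow> nat \<Rightarrow> real" where
  "pitman_ratio \<theta> \<alpha> n k =
     (if \<theta> = 0 then rising_step (\<theta> + \<alpha>) \<alpha> (k - 1) / pochhammer (\<theta> + 1) (n - 1)
      else rising_step \<theta> \<alpha> k / pochhammer \<theta> n)"

definition pitman_weight :: "real \<Rightarrow> real \<Rightarrow> nat \<Rightarrow> (nat \<Rightarrow> nat) \<Rightarrow> real" where
  "pitman_weight \<theta> \<alpha> n c =
     fact n * pitman_ratio \<theta> \<alpha> n (partition_length n c) *
     (\<Prod>i=1..n. (pochhammer (1 - \<alpha>) (i - 1) / fact i) ^ c i * (1 / fact (c i)))"

text \<open>\<open>C\<close> is a random variable on the probability space \<open>M\<close>, with values in \<open>partition_counts n\<close>,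
  that follows the Pitman sampling formula. Measurability into the discrete space on
  \<open>partition_counts n\<close> includes that \<open>C\<close> takes its values there.\<close>

definition pitman_partition ::
  "'a measure \<Rightarrow> ('a \<Rightarrow> nat \<Rightarrow> nat) \<Rightarrow> real \<Rightarrow> real \<Rightarrow> nat \<Rightarrow> bool" where
  "pitman_partition M C \<theta> \<alpha> n \<longleftrightarrow>
     prob_space M \<and>
     C \<in> measurable M (count_space (partition_counts n)) \<and>
     (\<forall>c\<in>partition_counts n. measure M {\<omega> \<in> space M. C \<omega> = c} = pitman_weight \<theta> \<alpha> n c)"

end

theory Submission
  imports Defs "HOL-Real_Asymp.Real_Asymp"
begin

text \<open>Write \<open>(x)\<^sub>j\<close> for the rising factorial and \<open>t = \<theta> / \<alpha>\<close>. Multiplying \<open>(\<theta>)\<^sub>k\<^sub>;\<^sub>\<alpha>\<close> by \<open>(k + t)\<^sub>j\<close> replaces the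
  parameter \<open>\<theta>\<close> by \<open>\<theta> + j\<alpha>\<close> up to a constant, and the unnormalised Pitman weights with parameter \<open>x\<close> sum
  to \<open>(x)\<^sub>n / n!\<close>. Hence the rising moment \<open>E[(K + t)\<^sub>j]\<close> is explicit: it is a constant times
  \<open>(\<theta> + j\<alpha>)\<^sub>n / (\<theta> + 1)\<^sub>n\<^sub>-\<^sub>1\<close>, which is \<open>n\<close> to the power \<open>j\<alpha>\<close> times a convergent sequence with error
  \<open>O(1/n)\<close>. Expanding \<open>K\<close> to the power \<open>r\<close> in the basis \<open>(K + t)\<^sub>j\<close>, the terms \<open>j = r\<close> and \<open>j = r - 1\<close> give
  the two main terms, and every term with \<open>j \<le> r - 2\<close> is of order \<open>1/n\<close> to the power \<open>2\<alpha>\<close> after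
  normalisation.\<close>

section \<open>Vectors of component counts and the removal of one part\<close>

text \<open>The bound \<open>N\<close> on the part sizes is kept apart from the total size \<open>m\<close>, so that removing a part
  changes only \<open>m\<close> and all weights remain products over the same index set.\<close>

definition counts :: "nat \<Rightarrow> nat \<Rightarrow> (nat \<Rightarrow> nat) set" where
  "counts N m = {c. (\<forall>i. i \<notin> {1..N} \<longrightarrow> c i = 0) \<and> (\<Sum>i=1..N. i * c i) = m}"

lemma partition_counts_eq: "partition_counts n = counts n n"
  by (simp add: partition_counts_def counts_def)

lemma finite_counts: "finite (counts N m)"
proof (rule finite_subset)
  show "counts N m \<subseteq> {c. \<forall>i. (i \<in> {1..N} \<longrightarrow> c i \<in> {..m}) \<and> (i \<notin> {1..N} \<longrightarrow> c i = 0)}"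
  proof (clarify, intro conjI impI)
    fix c i assume c: "c \<in> counts N m"
    show "c i = 0" if "i \<notin> {1..N}" using c that by (simp add: counts_def)
    assume i: "i \<in> {1..N}"
    then have "c i \<le> i * c i" by simp
    also have "\<dots> \<le> (\<Sum>i=1..N. i * c i)"
      by (rule member_le_sum) (use i in auto)
    finally show "c i \<in> {..m}" using c by (simp add: counts_def)
  qed
qed (intro finite_set_of_finite_funs; simp)

lemma counts_0: "counts N 0 = {\<lambda>_. 0}"
proof -
  have "c i = 0" if "c \<in> counts N 0" for c i
    using that by (cases "i \<in> {1..N}") (auto simp: counts_def)
  then have "counts N 0 \<subseteq> {\<lambda>_. 0}" by blast
  moreover have "(\<lambda>_. 0) \<in> counts N 0" by (simp add: counts_def)
  ultimately show ?thesis by blast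
qed

lemma counts_shift:
  assumes "i \<in> {1..N}"
  shows "c(i := Suc (c i)) \<in> counts N m \<longleftrightarrow> i \<le> m \<and> c \<in> counts N (m - i)"
proof -
  have "(\<Sum>j=1..N. j * (c(i := Suc (c i))) j) = i + (\<Sum>j=1..N. j * c j)"
    unfolding sum.remove[OF finite_atLeastAtMost assms] by simp
  then show ?thesis using assms by (auto simp: counts_def)
qed

definition counts_weight :: "nat \<Rightarrow> (nat \<Rightarrow> real) \<Rightarrow> (nat \<Rightarrow> nat) \<Rightarrow> real" where
  "counts_weight N w c = (\<Prod>i=1..N. w i ^ c i * (1 / fact (c i)))"

text \<open>Only the factor at \<open>i\<close> changes: it gains one \<open>w i\<close>, and
  \<open>Suc (c i)\<close> cancels against \<open>fact (Suc (c i))\<close>, leaving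
  \<open>fact (c i)\<close>.\<close>

lemma counts_weight_shift:
  assumes "i \<in> {1..N}"
  shows "real (Suc (c i)) * counts_weight N w (c(i := Suc (c i))) = w i * counts_weight N w c"
proof -
  have "counts_weight N w (c(i := Suc (c i))) =
        w i ^ Suc (c i) * (1 / fact (Suc (c i))) * (\<Prod>j\<in>{1..N} - {i}. w j ^ c j * (1 / fact (c j)))"
    unfolding counts_weight_def prod.remove[OF finite_atLeastAtMost assms] by simp
  moreover have "counts_weight N w c =
        w i ^ c i * (1 / fact (c i)) * (\<Prod>j\<in>{1..N} - {i}. w j ^ c j * (1 / fact (c j)))"
    unfolding counts_weight_def prod.remove[OF finite_atLeastAtMost assms] by simp
  ultimately show ?thesis by (simp del: of_nat_Suc)
qed

lemma partition_length_shift: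
  assumes "i \<in> {1..N}"
  shows "partition_length N (c(i := Suc (c i))) = Suc (partition_length N c)"
  unfolding partition_length_def sum.remove[OF finite_atLeastAtMost assms] by simp

text \<open>The factor \<open>c i\<close> is absorbed by \<open>1 / fact (c i)\<close>, so weighting
  by the number of parts of size \<open>i\<close> amounts to adding one such part to a vector of
  total \<open>m - i\<close>. The function \<open>f\<close> sees only the length, which grows by
  one.\<close>

lemma sum_counts_size_bias:
  fixes f :: "nat \<Rightarrow> real"
  assumes i: "i \<in> {1..N}"
  shows "(\<Sum>c\<in>counts N m. real (c i) * (f (partition_length N c) * counts_weight N w c)) =
    (if i \<le> m then w i * (\<Sum>c\<in>counts N (m - i). f (Suc (partition_length N c)) * counts_weight N w c) else 0)"
proof (cases "i \<le> m")
  case True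
  \<comment> \<open>Terms with \<open>c i = 0\<close> vanish; dropping them makes the subtraction
    \<open>c i - 1\<close> in the bijection below genuine.\<close>
  have "(\<Sum>c\<in>counts N m. real (c i) * (f (partition_length N c) * counts_weight N w c)) =
      (\<Sum>c\<in>{c \<in> counts N m. c i \<noteq> 0}. real (c i) * (f (partition_length N c) * counts_weight N w c))"
    by (rule sum.mono_neutral_right) (auto simp: finite_counts)
  also have "\<dots> = (\<Sum>c\<in>counts N (m - i). w i * (f (Suc (partition_length N c)) * counts_weight N w c))"
  proof (rule sum.reindex_bij_witness[where i = "\<lambda>c. c(i := Suc (c i))" and j = "\<lambda>c. c(i := c i - 1)"])
    fix c assume c: "c \<in> {c \<in> counts N m. c i \<noteq> 0}"
    let ?d = "c(i := c i - 1)"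
    from c have eq: "?d(i := Suc (?d i)) = c" by auto
    then show "?d(i := Suc (?d i)) = c" .
    show "?d \<in> counts N (m - i)"
      using counts_shift[OF i, of ?d m] c unfolding eq by simp
    show "w i * (f (Suc (partition_length N ?d)) * counts_weight N w ?d) =
        real (c i) * (f (partition_length N c) * counts_weight N w c)"
      using counts_weight_shift[OF i, of ?d w] partition_length_shift[OF i, of ?d] c
      unfolding eq by (simp add: algebra_simps)
  next
    fix c assume c: "c \<in> counts N (m - i)"
    show "c(i := Suc (c i)) \<in> {c \<in> counts N m. c i \<noteq> 0}"
      using counts_shift[OF i, of c m] c True by simp
    show "(c(i := Suc (c i)))(i := (c(i := Suc (c i))) i - 1) = c" by simp
  qed
  finally show ?thesis using True by (simp add: sum_distrib_left)
next
  case False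
  have "c i = 0" if c: "c \<in> counts N m" for c
  proof (rule ccontr)
    assume "c i \<noteq> 0"
    with i have "i \<le> i * c i" by simp
    also have "\<dots> \<le> (\<Sum>i=1..N. i * c i)"
      by (rule member_le_sum) (use i in auto)
    finally show False using c False by (simp add: counts_def)
  qed
  then show ?thesis using False by (simp add: sum.neutral)
qed

section \<open>Total mass of the unnormalised Pitman weights\<close>

lemma rising_step_pochhammer:
  assumes "y \<noteq> 0"
  shows "rising_step x y k = y ^ k * pochhammer (x / y) k"
proof (induction k)
  case (Suc k)
  have "x + real k * y = y * (x / y + real k)"
    using assms by (simp add: distrib_left)
  then show ?case
    using Suc by (simp add: rising_step_def pochhammer_Suc mult_ac)
qed (simp add: rising_step_def)

lemma rising_step_Suc_shift: "rising_step x y (Suc k) = x * rising_step (x + y) y k"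
  unfolding rising_step_def prod.lessThan_Suc_shift by (simp add: algebra_simps)

text \<open>Counting the total size \<open>m\<close> part by part and removing one part of size \<open>i\<close>
  shifts \<open>x\<close> to \<open>x + \<alpha>\<close>; the resulting recurrence is a Vandermonde convolution.\<close>

lemma sum_counts_rising_step:
  fixes \<alpha> :: real
  defines "w \<equiv> \<lambda>i. pochhammer (1 - \<alpha>) (i - 1) / fact i"
  assumes "m \<le> N"
  shows "(\<Sum>c\<in>counts N m. rising_step x \<alpha> (partition_length N c) * counts_weight N w c) =
         pochhammer x m / fact m"
  using \<open>m \<le> N\<close>
proof (induction m arbitrary: x rule: less_induct)
  case (less m)
  let ?Z = "\<lambda>m x. \<Sum>c\<in>counts N m. rising_step x \<alpha> (partition_length N c) * counts_weight N w c"
  show ?case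
  proof (cases m)
    case 0
    then show ?thesis
      by (simp add: counts_0 rising_step_def counts_weight_def partition_length_def)
  next
    case (Suc k)
    have "real m * ?Z m x =
      (\<Sum>c\<in>counts N m. (\<Sum>i=1..N. real i * (real (c i) *
          (rising_step x \<alpha> (partition_length N c) * counts_weight N w c))))"
    proof -
      have "real m * t = (\<Sum>i=1..N. real i * (real (c i) * t))" if "c \<in> counts N m" for c t
      proof -
        from that have "real m = (\<Sum>i=1..N. real i * real (c i))"
          unfolding counts_def by (auto simp flip: of_nat_mult of_nat_sum)
        then show ?thesis by (simp add: sum_distrib_right mult.assoc)
      qed
      then show ?thesis by (simp add: sum_distrib_left)
    qed
    also have "\<dots> = (\<Sum>i=1..N. real i * (\<Sum>c\<in>counts N m. real (c i) *
          (rising_step x \<alpha> (partition_length N c) * counts_weight N w c)))"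
      by (subst sum.swap) (simp add: sum_distrib_left)
    also have "\<dots> = (\<Sum>i=1..N. if i \<le> m then real i * (w i * (x * ?Z (m - i) (x + \<alpha>))) else 0)"
    proof (rule sum.cong[OF refl])
      fix i assume i: "i \<in> {1..N}"
      show "real i * (\<Sum>c\<in>counts N m. real (c i) *
          (rising_step x \<alpha> (partition_length N c) * counts_weight N w c)) =
        (if i \<le> m then real i * (w i * (x * ?Z (m - i) (x + \<alpha>))) else 0)"
        unfolding sum_counts_size_bias[OF i] rising_step_Suc_shift
        by (simp add: sum_distrib_left mult.assoc)
    qed
    also have "\<dots> = (\<Sum>i=1..m. real i * (w i * (x * ?Z (m - i) (x + \<alpha>))))"
      using less.prems by (intro sum.mono_neutral_cong_right) auto
    also have "\<dots> = (\<Sum>i=1..m. x * (pochhammer (1 - \<alpha>) (i - 1) / fact (i - 1) *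
        (pochhammer (x + \<alpha>) (m - i) / fact (m - i))))"
    proof (rule sum.cong[OF refl])
      fix i assume i: "i \<in> {1..m}"
      then have *: "?Z (m - i) (x + \<alpha>) = pochhammer (x + \<alpha>) (m - i) / fact (m - i)"
        using less.prems Suc by (intro less.IH) auto
      from i have "real i * w i = pochhammer (1 - \<alpha>) (i - 1) / fact (i - 1)"
        by (cases i) (auto simp: w_def simp del: of_nat_Suc)
      then show "real i * (w i * (x * ?Z (m - i) (x + \<alpha>))) = x * (pochhammer (1 - \<alpha>) (i - 1) / fact (i - 1) *
        (pochhammer (x + \<alpha>) (m - i) / fact (m - i)))"
        unfolding * by (simp add: mult.left_commute[of _ x] flip: mult.assoc)
    qed
    also have "\<dots> = (\<Sum>j\<le>k. x * (pochhammer (1 - \<alpha>) j / fact j *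
        (pochhammer (x + \<alpha>) (k - j) / fact (k - j))))"
      by (rule sum.reindex_bij_witness[where i = Suc and j = "\<lambda>i. i - 1"]) (auto simp: Suc)
    also have "\<dots> = x / fact k * (\<Sum>j\<le>k. real (k choose j) * pochhammer (1 - \<alpha>) j * pochhammer (x + \<alpha>) (k - j))"
      unfolding sum_distrib_left
      by (rule sum.cong) (simp_all add: binomial_fact mult_ac)
    \<comment> \<open>Vandermonde adds the two bases:
      \<open>(1 - \<alpha>) + (x + \<alpha>) = x + 1\<close>, so \<alpha> disappears.\<close>
    also have "\<dots> = x / fact k * pochhammer (x + 1) k"
      by (subst pochhammer_binomial_sum[symmetric]) (simp add: add.commute)
    also have "\<dots> = real m * (pochhammer x m / fact m)"
      unfolding Suc pochhammer_rec by (simp add: field_simps del: of_nat_Suc)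
    finally show ?thesis unfolding mult_cancel_left using Suc by (simp del: of_nat_Suc)
  qed
qed

section \<open>Rising moments of the partition length\<close>

text \<open>\<open>C\<close> takes finitely many values, so \<open>f (C \<omega>)\<close> is a
  finite combination of indicators of the events \<open>C \<omega> = c\<close>.\<close>

lemma expectation_pitman_partition:
  fixes f :: "(nat \<Rightarrow> nat) \<Rightarrow> real"
  assumes "pitman_partition M C \<theta> \<alpha> n"
  shows "(\<integral>\<omega>. f (C \<omega>) \<partial>M) = (\<Sum>c\<in>partition_counts n. f c * pitman_weight \<theta> \<alpha> n c)"
proof -
  let ?A = "\<lambda>c. {\<omega> \<in> space M. C \<omega> = c}"
  interpret prob_space M using assms by (simp add: pitman_partition_def)
  have C: "C \<in> measurable M (count_space (partition_counts n))"
    using assms by (simp add: pitman_partition_def)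
  have fin: "finite (partition_counts n)"
    by (simp add: partition_counts_eq finite_counts)
  have sets: "?A c \<in> events" if "c \<in> partition_counts n" for c
    using measurable_sets[OF C, of "{c}"] that by (simp add: vimage_def Int_def conj_commute)
  have "(\<integral>\<omega>. f (C \<omega>) \<partial>M) = (\<integral>\<omega>. (\<Sum>c\<in>partition_counts n. f c * indicator (?A c) \<omega>) \<partial>M)"
  proof (rule Bochner_Integration.integral_cong[OF refl])
    fix \<omega> assume \<omega>: "\<omega> \<in> space M"
    then have "C \<omega> \<in> partition_counts n" using measurable_space[OF C] by simp
    moreover have "(\<Sum>c\<in>partition_counts n. f c * indicator (?A c) \<omega>) =
        (\<Sum>c\<in>partition_counts n. if C \<omega> = c then f c else 0)"
      using \<omega> by (intro sum.cong) (auto simp: indicator_def)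
    ultimately show "f (C \<omega>) = (\<Sum>c\<in>partition_counts n. f c * indicator (?A c) \<omega>)"
      using fin by simp
  qed
  also have "\<dots> = (\<Sum>c\<in>partition_counts n. f c * prob (?A c))"
  proof (subst Bochner_Integration.integral_sum)
    fix c assume "c \<in> partition_counts n"
    then show "integrable M (\<lambda>\<omega>. f c * indicator (?A c) \<omega>)"
      using sets by (intro integrable_mult_right integrable_real_indicator) (auto simp: emeasure_eq_measure)
  qed (auto intro!: sum.cong simp: sets)
  also have "\<dots> = (\<Sum>c\<in>partition_counts n. f c * pitman_weight \<theta> \<alpha> n c)"
    using assms by (intro sum.cong) (auto simp: pitman_partition_def)
  finally show ?thesis .
qed

text \<open>Both rising factorials have first factor \<theta>, so the cancelled form is valid for
  every \<theta> and the case \<theta> = 0 needs no separate treatment later.\<close>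

lemma pitman_ratio_cancelled:
  assumes "1 \<le> k" "1 \<le> n"
  shows "pitman_ratio \<theta> \<alpha> n k = rising_step (\<theta> + \<alpha>) \<alpha> (k - 1) / pochhammer (\<theta> + 1) (n - 1)"
proof -
  obtain k' n' where "k = Suc k'" "n = Suc n'" using assms by (metis Suc_le_D One_nat_def)
  then show ?thesis by (simp add: pitman_ratio_def rising_step_Suc_shift pochhammer_rec)
qed

lemma partition_length_pos:
  assumes "c \<in> partition_counts n" "1 \<le> n"
  shows "1 \<le> partition_length n c"
proof (rule ccontr)
  assume "\<not> 1 \<le> partition_length n c"
  then have "partition_length n c = 0" by simp
  then have "\<forall>i\<in>{1..n}. c i = 0" by (simp add: partition_length_def)
  then have "(\<Sum>i=1..n. i * c i) = 0" by simp
  then show False using assms by (simp add: partition_counts_def)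
qed

text \<open>With \<open>?t = 1 + \<theta> / \<alpha>\<close>, both sides split the same rising
  factorial of \<open>?t\<close> with \<open>k + j - 1\<close> factors: once after
  \<open>k - 1\<close> factors, once after \<open>j - 1\<close>. The division by \<alpha> balances
  the powers of \<alpha> with exponents \<open>k - 1\<close> and \<open>k\<close>.\<close>

lemma rising_step_shift_parameter:
  assumes "\<alpha> \<noteq> 0" "1 \<le> k" "1 \<le> j"
  shows "pochhammer (real k + \<theta> / \<alpha>) j * rising_step (\<theta> + \<alpha>) \<alpha> (k - 1) =
         pochhammer (1 + \<theta> / \<alpha>) (j - 1) / \<alpha> * rising_step (\<theta> + real j * \<alpha>) \<alpha> k"
proof -
  obtain k' j' where [simp]: "k = Suc k'" "j = Suc j'" using assms by (metis Suc_le_D One_nat_def)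
  let ?t = "1 + \<theta> / \<alpha>"
  have t: "(\<theta> + \<alpha>) / \<alpha> = ?t" "(\<theta> + real j * \<alpha>) / \<alpha> = ?t + real j'"
    "real k + \<theta> / \<alpha> = ?t + real k'"
    using assms(1) by (simp_all add: field_simps)
  have "pochhammer ?t k' * pochhammer (?t + real k') (Suc j') = pochhammer ?t (k' + Suc j')"
    by (rule pochhammer_product'[symmetric])
  also have "k' + Suc j' = j' + Suc k'" by simp
  also have "pochhammer ?t (j' + Suc k') = pochhammer ?t j' * pochhammer (?t + real j') (Suc k')"
    by (rule pochhammer_product')
  finally have "pochhammer (?t + real k') j * pochhammer ?t (k - 1) =
      pochhammer ?t (j - 1) * pochhammer (?t + real j') k"
    by (simp add: mult.commute)
  then have "pochhammer (?t + real k') j * (\<alpha> ^ (k - 1) * pochhammer ?t (k - 1)) =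
      pochhammer ?t (j - 1) / \<alpha> * (\<alpha> ^ k * pochhammer (?t + real j') k)"
    using assms(1) by (simp add: mult.left_commute)
  then show ?thesis unfolding rising_step_pochhammer[OF assms(1)] t .
qed

text \<open>The rising factorial turns the weights into unnormalised ones with parameter
  \<open>\<theta> + j * \<alpha>\<close>, whose total mass is known. The index \<open>j - 1\<close>
  excludes \<open>j = 0\<close>, where the moment is simply the total probability.\<close>

lemma pitman_rising_moment:
  assumes "\<alpha> \<noteq> 0" "1 \<le> n" "1 \<le> j"
  shows "(\<Sum>c\<in>partition_counts n. pochhammer (real (partition_length n c) + \<theta> / \<alpha>) j * pitman_weight \<theta> \<alpha> n c) =
    pochhammer (1 + \<theta> / \<alpha>) (j - 1) / \<alpha> * (pochhammer (\<theta> + real j * \<alpha>) n / pochhammer (\<theta> + 1) (n - 1))"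
proof -
  let ?w = "\<lambda>i. pochhammer (1 - \<alpha>) (i - 1) / fact i"
  let ?D = "pochhammer (\<theta> + 1) (n - 1)"
  let ?a = "pochhammer (1 + \<theta> / \<alpha>) (j - 1) / \<alpha>"
  have "pochhammer (real (partition_length n c) + \<theta> / \<alpha>) j * pitman_weight \<theta> \<alpha> n c =
      fact n * ?a / ?D * (rising_step (\<theta> + real j * \<alpha>) \<alpha> (partition_length n c) * counts_weight n ?w c)"
    if c: "c \<in> counts n n" for c
  proof -
    let ?k = "partition_length n c"
    have k: "1 \<le> ?k" using partition_length_pos assms c by (simp add: partition_counts_eq)
    have "pochhammer (real ?k + \<theta> / \<alpha>) j * pitman_weight \<theta> \<alpha> n c =
        fact n / ?D * (pochhammer (real ?k + \<theta> / \<alpha>) j * rising_step (\<theta> + \<alpha>) \<alpha> (?k - 1)) * counts_weight n ?w c"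
      using assms k by (simp add: pitman_weight_def pitman_ratio_cancelled counts_weight_def)
    then show ?thesis
      unfolding rising_step_shift_parameter[OF assms(1) k assms(3)] by (simp add: mult_ac)
  qed
  then have "(\<Sum>c\<in>partition_counts n. pochhammer (real (partition_length n c) + \<theta> / \<alpha>) j * pitman_weight \<theta> \<alpha> n c) =
    fact n * ?a / ?D * (\<Sum>c\<in>counts n n. rising_step (\<theta> + real j * \<alpha>) \<alpha> (partition_length n c) * counts_weight n ?w c)"
    by (simp add: partition_counts_eq sum_distrib_left)
  also have "\<dots> = ?a * (pochhammer (\<theta> + real j * \<alpha>) n / ?D)"
    unfolding sum_counts_rising_step[OF order_refl] by simp
  finally show ?thesis .
qed

section \<open>Ratios of rising factorials with an error rate\<close>

text \<open>The distance to the limit is at most the sum of the remaining increments, and the tails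
  of the series of \<open>1 / n^2\<close> are of order \<open>1 / n\<close>.\<close>

lemma LIMSEQ_rate_of_increments:
  fixes w :: "nat \<Rightarrow> real"
  assumes lim: "w \<longlonglongrightarrow> l" and incr: "(\<lambda>n. w (Suc n) - w n) \<in> O(\<lambda>n. 1 / real n ^ 2)"
  shows "(\<lambda>n. w n - l) \<in> O(\<lambda>n. 1 / real n)"
proof -
  from incr obtain c where c: "c > 0"
    "eventually (\<lambda>n. norm (w (Suc n) - w n) \<le> c * norm (1 / real n ^ 2)) at_top"
    by (rule landau_o.bigE)
  then obtain N where N: "\<And>n. n \<ge> N \<Longrightarrow> norm (w (Suc n) - w n) \<le> c * norm (1 / real n ^ 2)"
    by (auto simp: eventually_at_top_linorder)
  \<comment> \<open>The corrections telescope against the increments: eventually \<open>?u\<close>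
    decreases and \<open>?v\<close> increases, both to \<open>l\<close>, so they enclose
    \<open>l\<close> and bound \<open>w n - l\<close>.\<close>
  let ?u = "\<lambda>n. w n + c / (real n - 1)" and ?v = "\<lambda>n. w n - c / (real n - 1)"
  have step: "\<bar>w (Suc n) - w n\<bar> \<le> c / (real n - 1) - c / (real (Suc n) - 1)" if "n \<ge> max N 2" for n
  proof -
    have "\<bar>w (Suc n) - w n\<bar> \<le> c * (1 / real n ^ 2)" using N[of n] that by simp
    also have "\<dots> \<le> c * (1 / ((real n - 1) * real n))"
      using that c by (intro mult_left_mono divide_left_mono) (auto simp: power2_eq_square)
    also have "\<dots> = c / (real n - 1) - c / (real (Suc n) - 1)"
      using that by (simp add: field_simps)
    finally show ?thesis .
  qed
  have c0: "(\<lambda>n. c / (real n - 1)) \<longlonglongrightarrow> 0" by real_asymp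
  have bound: "\<bar>w n - l\<bar> \<le> c / (real n - 1)" if n: "n \<ge> max N 2" for n
  proof -
    have "?u (n + m) \<le> ?u n \<and> ?v (n + m) \<ge> ?v n" for m
    proof (induction m)
      case (Suc m)
      then show ?case using step[of "n + m"] n by (simp add: abs_le_iff)
    qed simp
    moreover have "(\<lambda>m. ?u (m + n)) \<longlonglongrightarrow> l + 0" "(\<lambda>m. ?v (m + n)) \<longlonglongrightarrow> l - 0"
      by (intro LIMSEQ_ignore_initial_segment tendsto_intros lim c0)+
    ultimately have "l + 0 \<le> ?u n" "?v n \<le> l - 0"
      by (auto intro: LIMSEQ_le_const LIMSEQ_le_const2 simp: add.commute[of _ n])
    then show ?thesis by linarith
  qed
  have "(\<lambda>n. w n - l) \<in> O(\<lambda>n. c / (real n - 1))"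
  proof (rule landau_o.big_mono, rule eventually_mono[OF eventually_ge_at_top[of "max N 2"]])
    fix n assume "max N 2 \<le> n"
    then have "\<bar>w n - l\<bar> \<le> c / (real n - 1)" by (rule bound)
    also have "\<dots> \<le> \<bar>c / (real n - 1)\<bar>" by (rule abs_ge_self)
    finally show "norm (w n - l) \<le> norm (c / (real n - 1))" by simp
  qed
  also have "(\<lambda>n. c / (real n - 1)) \<in> O(\<lambda>n. 1 / real n)" by real_asymp
  finally show ?thesis .
qed

text \<open>The limit comes from the Gamma series, the rate from the size of the increments.\<close>

lemma pochhammer_ratio_asymptotics:
  fixes a b :: real
  assumes a: "a > 0" and b: "b > 0"
  shows "(\<lambda>n. pochhammer a n / pochhammer b (n - 1) / real n powr (a - b + 1) - Gamma b / Gamma a)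
         \<in> O(\<lambda>n. 1 / real n)"
proof (rule LIMSEQ_rate_of_increments)
  let ?w = "\<lambda>n. pochhammer a n / pochhammer b (n - 1) / real n powr (a - b + 1)"
  have pos: "pochhammer a n > 0" "pochhammer b n > 0" for n
    using a b by (simp_all add: pochhammer_pos)
  \<comment> \<open>The factor \<open>(b + n - 1) / n\<close> accounts for the denominator stopping
    at \<open>n - 1\<close> instead of \<open>n\<close>; it tends to 1.\<close>
  have "(\<lambda>n. Gamma_series' b n / Gamma_series' a n * ((b + real n - 1) / real n))
      \<longlonglongrightarrow> Gamma b / Gamma a * 1"
  proof (intro tendsto_mult tendsto_divide Gamma_series'_LIMSEQ)
    show "Gamma a \<noteq> 0" using Gamma_real_pos[OF a] by simp
    show "(\<lambda>n. (b + real n - 1) / real n) \<longlonglongrightarrow> 1" by real_asymp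
  qed
  moreover have "eventually (\<lambda>n. Gamma_series' b n / Gamma_series' a n * ((b + real n - 1) / real n) = ?w n) at_top"
    using eventually_gt_at_top[of 0]
  proof eventually_elim
    case (elim n)
    then obtain m where m: "n = Suc m" by (cases n) auto
    define B where "B = b + real n - 1"
    have powr: "real n powr (a - b + 1) = exp (a * ln (real n)) / exp (b * ln (real n)) * real n"
      using elim by (simp add: powr_add powr_diff) (simp add: powr_def)
    have poch: "pochhammer b n = pochhammer b (n - 1) * B"
      by (simp add: m pochhammer_Suc B_def algebra_simps)
    have "B > 0" using b elim by (simp add: B_def)
    then show ?case
      unfolding Gamma_series'_def powr poch B_def[symmetric]
      using pos(1)[of n] pos(2)[of "n - 1"] elim by (simp add: divide_simps)
  qed
  ultimately show lim: "?w \<longlonglongrightarrow> Gamma b / Gamma a"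
    using tendsto_cong by fastforce
  \<comment> \<open>\<open>?q\<close> is the relative increment of \<open>?w\<close>. The exponent
    \<open>a - b + 1\<close> is the one for which the terms of order \<open>1 / n\<close> in its
    expansion cancel.\<close>
  let ?q = "\<lambda>n. (a + real n) / (b + real n - 1) * (real n / (real n + 1)) powr (a - b + 1) - 1"
  have "(\<lambda>n. ?w n * ?q n) \<in> O(\<lambda>n. 1 * (1 / real n ^ 2))"
  proof (rule landau_o.big.mult)
    show "?w \<in> O(\<lambda>_. 1)" using lim by (intro bigoI_tendsto[where c = "Gamma b / Gamma a"]) simp_all
    show "?q \<in> O(\<lambda>n. 1 / real n ^ 2)" using a b by real_asymp
  qed
  moreover have "eventually (\<lambda>n. ?w n * ?q n = ?w (Suc n) - ?w n) at_top"
    using eventually_gt_at_top[of 0]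
  proof eventually_elim
    case (elim n)
    then obtain m where m: "n = Suc m" by (cases n) auto
    define e B where "e = a - b + 1" and "B = b + real n - 1"
    have "(real n / (real n + 1)) powr e = real n powr e / real (Suc n) powr e"
      by (simp add: powr_divide add.commute)
    then have "?w n * (?q n + 1) = pochhammer a n / pochhammer b (n - 1) / real n powr e *
        ((a + real n) / B * (real n powr e / real (Suc n) powr e))"
      by (simp add: e_def B_def)
    also have "\<dots> = pochhammer a n * (a + real n) / (pochhammer b (n - 1) * B) / real (Suc n) powr e"
      using elim by simp
    also have "pochhammer a n * (a + real n) = pochhammer a (Suc n)"
      by (simp add: pochhammer_Suc)
    also have "pochhammer b (n - 1) * B = pochhammer b (Suc n - 1)"
      by (simp add: m pochhammer_Suc B_def algebra_simps)
    finally have "?w n * (?q n + 1) = ?w (Suc n)" unfolding e_def .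
    then show ?case by (simp add: algebra_simps)
  qed
  ultimately show "(\<lambda>n. ?w (Suc n) - ?w n) \<in> O(\<lambda>n. 1 / real n ^ 2)"
    using landau_o.big.in_cong by fastforce
qed

section \<open>Powers in the basis of shifted rising factorials\<close>

text \<open>The recurrence encodes
  \<open>x * (x + y)_j = (x + y)_{j+1} - (y + j) * (x + y)_j\<close>. For \<open>y = 0\<close> these
  are the Stirling numbers of the second kind with sign \<open>(-1)^(r - j)\<close>.\<close>

fun pochhammer_coeff :: "real \<Rightarrow> nat \<Rightarrow> nat \<Rightarrow> real" where
  "pochhammer_coeff y 0 j = (if j = 0 then 1 else 0)"
| "pochhammer_coeff y (Suc r) j =
     (if j = 0 then 0 else pochhammer_coeff y r (j - 1)) - (y + real j) * pochhammer_coeff y r j"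

lemma pochhammer_coeff_eq_0: "r < j \<Longrightarrow> pochhammer_coeff y r j = 0"
  by (induction r arbitrary: j) auto

lemma pochhammer_coeff_diag: "pochhammer_coeff y r r = 1"
  by (induction r) (auto simp: pochhammer_coeff_eq_0)

text \<open>Along the subdiagonal the recurrence accumulates \<open>-(y + j)\<close> for
  \<open>j = 0, ..., r\<close>. With \<open>y = \<theta> / \<alpha>\<close> this is the source of
  the constant in the second-order term of the theorem.\<close>

lemma pochhammer_coeff_subdiag:
  "pochhammer_coeff y (Suc r) r = - ((real r + 1) * real r / 2 + (real r + 1) * y)"
  by (induction r) (auto simp: pochhammer_coeff_diag field_simps)

lemma power_eq_sum_pochhammer:
  "x ^ r = (\<Sum>j\<le>r. pochhammer_coeff y r j * pochhammer (x + y) j)"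
proof (induction r)
  case (Suc r)
  let ?a = "pochhammer_coeff y r" and ?P = "pochhammer (x + y)"
  have "(\<Sum>j\<le>Suc r. pochhammer_coeff y (Suc r) j * ?P j) =
      (\<Sum>j\<le>Suc r. (if j = 0 then 0 else ?a (j - 1)) * ?P j) - (\<Sum>j\<le>Suc r. (y + real j) * ?a j * ?P j)"
    by (simp add: sum_subtractf left_diff_distrib del: sum.atMost_Suc)
  also have "(\<Sum>j\<le>Suc r. (if j = 0 then 0 else ?a (j - 1)) * ?P j) = (\<Sum>j\<le>r. ?a j * ?P (Suc j))"
    by (subst sum.atMost_Suc_shift) simp
  also have "(\<Sum>j\<le>Suc r. (y + real j) * ?a j * ?P j) = (\<Sum>j\<le>r. (y + real j) * ?a j * ?P j)"
    by (simp add: pochhammer_coeff_eq_0)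
  also have "(\<Sum>j\<le>r. ?a j * ?P (Suc j)) - (\<Sum>j\<le>r. (y + real j) * ?a j * ?P j) = x * (\<Sum>j\<le>r. ?a j * ?P j)"
    unfolding sum_subtractf[symmetric] sum_distrib_left
    by (rule sum.cong) (auto simp: pochhammer_Suc algebra_simps)
  finally show ?case using Suc by simp
qed simp

section \<open>The expansion of the moments\<close>

theorem theorem3p1:
  fixes \<alpha> \<theta> :: real and r :: nat
    and M :: "nat \<Rightarrow> 'a measure" and C :: "nat \<Rightarrow> 'a \<Rightarrow> nat \<Rightarrow> nat"
  assumes "0 < \<alpha>" and "\<alpha> < 1" and "\<theta> > - \<alpha>" and "r \<ge> 1"
    and "\<And>n. n \<ge> 1 \<Longrightarrow> pitman_partition (M n) (C n) \<theta> \<alpha> n"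
  shows "(\<lambda>n. (\<integral>\<omega>. (real (partition_length n (C n \<omega>)) / real n powr \<alpha>) ^ r \<partial>M n)
            - pochhammer (1 + \<theta> / \<alpha>) r * (Gamma (\<theta> + 1) / Gamma (\<theta> + real r * \<alpha> + 1)) *
              (1 - (real r * (real r - 1) * \<alpha> / 2 + real r * \<theta>) *
                   (Gamma (\<theta> + real r * \<alpha>) / Gamma (\<theta> + (real r - 1) * \<alpha> + 1)) *
                   (1 / real n powr \<alpha>)))
         \<in> O(\<lambda>n. 1 / real n powr (2 * \<alpha>) + 1 / real n)"
proof -
  define t where "t = \<theta> / \<alpha>"
  define m where "m = (\<lambda>n j. \<Sum>c\<in>partition_counts n.
      pochhammer (real (partition_length n c) + t) j * pitman_weight \<theta> \<alpha> n c)"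
  \<comment> \<open>\<open>L j\<close> is the limit of the rising moment \<open>m n j\<close>
    divided by \<open>n powr (j * \<alpha>)\<close>.\<close>
  define L where "L = (\<lambda>j. pochhammer (1 + t) j * (Gamma (\<theta> + 1) / Gamma (\<theta> + real j * \<alpha> + 1)))"
  define a where "a = pochhammer_coeff t r"
  define g where "g = (\<lambda>n. 1 / real n powr (2 * \<alpha>) + 1 / real n)"
  \<comment> \<open>The power of \<open>n\<close> left over when the \<open>j\<close>-th rising
    moment is normalised by \<open>n powr (r * \<alpha>)\<close>; the sums below have
    \<open>j \<le> r\<close>, so \<open>r - j\<close> is genuine there.\<close>
  define p where "p = (\<lambda>n j. real n powr - (real (r - j) * \<alpha>))"
  obtain s where s: "r = Suc s" using assms(4) by (metis Suc_le_D One_nat_def)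
  have pos: "\<theta> + 1 > 0" using assms by linarith

  have moment: "(\<lambda>n. m n j / real n powr (real j * \<alpha>) - L j) \<in> O(\<lambda>n. 1 / real n)" for j
  proof (cases j)
    case 0
    have "eventually (\<lambda>n. m n j / real n powr (real j * \<alpha>) - L j = 0) at_top"
      using eventually_gt_at_top[of 0]
    proof eventually_elim
      case (elim n)
      with assms(5)[of n] have *: "pitman_partition (M n) (C n) \<theta> \<alpha> n" by simp
      then interpret prob_space "M n" by (simp add: pitman_partition_def)
      have "m n 0 = 1"
        using expectation_pitman_partition[OF *, of "\<lambda>_. 1"] by (simp add: m_def prob_space)
      then show ?case using 0 elim Gamma_real_pos[OF pos] by (simp add: L_def)
    qed
    from landau_o.big.in_cong[OF this] show ?thesis by simp
  next
    case (Suc i)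
    let ?b = "pochhammer (1 + t) i / \<alpha>"
    have a0: "\<theta> + real j * \<alpha> > 0"
    proof -
      have "real j * \<alpha> \<ge> 1 * \<alpha>" using assms(1) Suc by (intro mult_right_mono) auto
      then show ?thesis using assms(3) by linarith
    qed
    \<comment> \<open>The last factor of \<open>(1 + t)_j\<close> is
      \<open>(\<theta> + j * \<alpha>) / \<alpha>\<close>, which lowers the argument of Gamma in the
      denominator by one.\<close>
    have "L j = ?b * (Gamma (\<theta> + 1) / Gamma (\<theta> + real j * \<alpha>))"
    proof -
      have "Gamma (\<theta> + real j * \<alpha> + 1) = (\<theta> + real j * \<alpha>) * Gamma (\<theta> + real j * \<alpha>)"
        using a0 by (intro Gamma_plus1) (auto elim!: nonpos_Ints_cases)
      moreover have "pochhammer (1 + t) j = ?b * (\<theta> + real j * \<alpha>)"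
        using assms(1) by (simp add: Suc pochhammer_Suc t_def field_simps)
      ultimately show ?thesis using a0 by (simp add: L_def)
    qed
    moreover have "eventually (\<lambda>n. m n j = ?b * (pochhammer (\<theta> + real j * \<alpha>) n / pochhammer (\<theta> + 1) (n - 1))) at_top"
      using eventually_gt_at_top[of 0]
    proof eventually_elim
      case (elim n)
      then show ?case
        using pitman_rising_moment[of \<alpha> n j \<theta>] assms(1) Suc by (simp add: m_def t_def)
    qed
    \<comment> \<open>The exponent is left in the form \<open>a - b + 1\<close> with
      \<open>a = \<theta> + j * \<alpha>\<close> and \<open>b = \<theta> + 1\<close>; it equals
      \<open>j * \<alpha>\<close>.\<close>
    ultimately have "eventually (\<lambda>n. ?b * (pochhammer (\<theta> + real j * \<alpha>) n / pochhammer (\<theta> + 1) (n - 1) /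
          real n powr ((\<theta> + real j * \<alpha>) - (\<theta> + 1) + 1) - Gamma (\<theta> + 1) / Gamma (\<theta> + real j * \<alpha>))
        = m n j / real n powr (real j * \<alpha>) - L j) at_top"
      by (auto elim!: eventually_mono simp: right_diff_distrib)
    moreover have "(\<lambda>n. ?b * (pochhammer (\<theta> + real j * \<alpha>) n / pochhammer (\<theta> + 1) (n - 1) /
          real n powr ((\<theta> + real j * \<alpha>) - (\<theta> + 1) + 1) - Gamma (\<theta> + 1) / Gamma (\<theta> + real j * \<alpha>)))
        \<in> O(\<lambda>n. 1 * (1 / real n))"
      by (intro landau_o.big.mult bigo_const pochhammer_ratio_asymptotics a0 pos)
    ultimately show ?thesis by (simp only: landau_o.big.in_cong mult_1_left)
  qed

  have g1: "(\<lambda>n. 1 / real n) \<in> O(g)" and g2: "(\<lambda>n. real n powr - (2 * \<alpha>)) \<in> O(g)"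
    by (rule landau_o.big_mono, simp add: g_def powr_minus_divide)+
  have p1: "(\<lambda>n. p n j) \<in> O(\<lambda>_. 1)" for j
  proof (rule landau_o.big_mono, rule eventually_mono[OF eventually_gt_at_top[of 0]])
    fix n :: nat assume "0 < n"
    then show "norm (p n j) \<le> norm (1::real)"
      using assms(1) powr_mono[of "- (real (r - j) * \<alpha>)" 0 "real n"] by (simp add: p_def)
  qed
  have p2: "(\<lambda>n. p n j) \<in> O(g)" if "j < s" for j
  proof -
    have "2 \<le> real (r - j)" using that s by simp
    then have le: "2 * \<alpha> \<le> real (r - j) * \<alpha>" using assms(1) by (intro mult_right_mono) auto
    have "(\<lambda>n. p n j) \<in> O(\<lambda>n. real n powr - (2 * \<alpha>))"
      unfolding p_def
      by (rule landau_o.big_mono, rule eventually_mono[OF eventually_gt_at_top[of 0]])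
        (use le in \<open>auto intro!: powr_mono\<close>)
    then show ?thesis using g2 by (rule landau_o.big_trans)
  qed

  \<comment> \<open>The whole remainder: the deviations of all normalised moments from their limits,
    of order \<open>1 / n\<close>, and the limit terms with \<open>r - j \<ge> 2\<close>. The limit
    terms \<open>j = r\<close> and \<open>j = s\<close> are left for the main part.\<close>
  have "(\<lambda>n. (\<Sum>j\<le>r. a j * ((m n j / real n powr (real j * \<alpha>) - L j) * p n j)) +
      (\<Sum>j<s. a j * (L j * p n j))) \<in> O(g)"
  proof (intro sum_in_bigo(1) big_sum_in_bigo)
    fix j
    have "(\<lambda>n. (m n j / real n powr (real j * \<alpha>) - L j) * p n j) \<in> O(\<lambda>n. 1 / real n * 1)"
      by (intro landau_o.big.mult moment p1)
    then have *: "(\<lambda>n. (m n j / real n powr (real j * \<alpha>) - L j) * p n j) \<in> O(g)"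
      using g1 landau_o.big_trans by (simp only: mult_1_right)
    show "(\<lambda>n. a j * ((m n j / real n powr (real j * \<alpha>) - L j) * p n j)) \<in> O(g)"
      using * by (cases "a j = 0") simp_all
  next
    fix j assume "j \<in> {..<s}"
    then have "(\<lambda>n. p n j) \<in> O(g)" using p2 by simp
    then show "(\<lambda>n. a j * (L j * p n j)) \<in> O(g)"
      by (cases "a j = 0"; cases "L j = 0") simp_all
  qed
  moreover have "eventually (\<lambda>n. (\<Sum>j\<le>r. a j * ((m n j / real n powr (real j * \<alpha>) - L j) * p n j)) +
      (\<Sum>j<s. a j * (L j * p n j)) =
      (\<integral>\<omega>. (real (partition_length n (C n \<omega>)) / real n powr \<alpha>) ^ r \<partial>M n)
            - pochhammer (1 + \<theta> / \<alpha>) r * (Gamma (\<theta> + 1) / Gamma (\<theta> + real r * \<alpha> + 1)) *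
              (1 - (real r * (real r - 1) * \<alpha> / 2 + real r * \<theta>) *
                   (Gamma (\<theta> + real r * \<alpha>) / Gamma (\<theta> + (real r - 1) * \<alpha> + 1)) *
                   (1 / real n powr \<alpha>))) at_top"
    using eventually_gt_at_top[of 0]
  proof eventually_elim
    case (elim n)
    with assms(5)[of n] have pp: "pitman_partition (M n) (C n) \<theta> \<alpha> n" by simp
    have rp: "(real n powr \<alpha>) ^ r = real n powr (real r * \<alpha>)"
      using elim by (simp add: powr_realpow[symmetric] powr_powr mult.commute)
    have pw: "p n j / real n powr (real j * \<alpha>) = 1 / (real n powr \<alpha>) ^ r" if "j \<le> r" for j
      unfolding rp p_def using that elim
      by (simp add: powr_minus_divide of_nat_diff flip: powr_add) (simp add: algebra_simps)
    have "(\<integral>\<omega>. (real (partition_length n (C n \<omega>)) / real n powr \<alpha>) ^ r \<partial>M n) =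
        (\<Sum>c\<in>partition_counts n. (real (partition_length n c) / real n powr \<alpha>) ^ r * pitman_weight \<theta> \<alpha> n c)"
      by (rule expectation_pitman_partition[OF pp])
    also have "\<dots> = (\<Sum>c\<in>partition_counts n. \<Sum>j\<le>r. 1 / (real n powr \<alpha>) ^ r * (a j *
         (pochhammer (real (partition_length n c) + t) j * pitman_weight \<theta> \<alpha> n c)))"
      unfolding power_divide power_eq_sum_pochhammer[of "real (partition_length n _)" r t] a_def
      by (simp add: sum_distrib_left sum_distrib_right sum_divide_distrib mult_ac)
    also have "\<dots> = (\<Sum>j\<le>r. a j * m n j * (1 / (real n powr \<alpha>) ^ r))"
      by (subst sum.swap) (simp add: m_def sum_distrib_left sum_distrib_right sum_divide_distrib mult_ac)
    also have "\<dots> = (\<Sum>j\<le>r. a j * (m n j / real n powr (real j * \<alpha>) * p n j))"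
      using pw by (intro sum.cong) (auto simp flip: pw)
    finally have E: "(\<integral>\<omega>. (real (partition_length n (C n \<omega>)) / real n powr \<alpha>) ^ r \<partial>M n) =
      (\<Sum>j\<le>r. a j * (m n j / real n powr (real j * \<alpha>) * p n j))" .
    have G: "Gamma (\<theta> + real r * \<alpha>) > 0" "\<theta> + real r * \<alpha> > 0"
    proof -
      have "\<theta> + \<alpha> > 0" using assms(3) by simp
      moreover have "real s * \<alpha> \<ge> 0" using assms(1) by simp
      ultimately show "\<theta> + real r * \<alpha> > 0" unfolding s of_nat_Suc distrib_right by linarith
      then show "Gamma (\<theta> + real r * \<alpha>) > 0" by (rule Gamma_real_pos)
    qed
    have ar: "a r = 1" by (simp add: a_def pochhammer_coeff_diag)
    have as: "a s * \<alpha> = - (real r * (real r - 1) * \<alpha> / 2 + real r * \<theta>)"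
      unfolding a_def s pochhammer_coeff_subdiag t_def using assms(1) by (simp add: field_simps)
    \<comment> \<open>This rewrites the coefficient from \<open>j = s\<close> as a multiple of
      \<open>L r\<close>, so that \<open>L r\<close> can be factored out as in the claim.\<close>
    have Lr: "L r * Gamma (\<theta> + real r * \<alpha>) / Gamma (\<theta> + (real r - 1) * \<alpha> + 1) = L s / \<alpha>"
    proof -
      have "Gamma (\<theta> + real r * \<alpha> + 1) = (\<theta> + real r * \<alpha>) * Gamma (\<theta> + real r * \<alpha>)"
        using G by (intro Gamma_plus1) (auto elim!: nonpos_Ints_cases)
      moreover have "pochhammer (1 + t) r = pochhammer (1 + t) s / \<alpha> * (\<theta> + real r * \<alpha>)"
        using assms(1) by (simp add: s pochhammer_Suc t_def field_simps)
      moreover have "real r - 1 = real s" by (simp add: s)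
      moreover have "Gamma (\<theta> + real r * \<alpha>) \<noteq> 0" using G(1) by simp
      ultimately show ?thesis using G(2) by (simp add: L_def)
    qed
    \<comment> \<open>The top term is exactly \<open>L r\<close>, because \<open>a r = 1\<close> and
      \<open>p n r = 1\<close> for positive \<open>n\<close>.\<close>
    have "(\<Sum>j\<le>r. a j * (L j * p n j)) = (\<Sum>j<s. a j * (L j * p n j)) + a s * (L s * p n s) + L r"
      using elim by (simp add: s lessThan_Suc_atMost[symmetric] ar[unfolded s] p_def)
    also have "a s * (L s * p n s) = (a s * \<alpha>) * (L s / \<alpha>) * (1 / real n powr \<alpha>)"
      using assms(1) by (simp add: p_def s powr_minus_divide)
    also have "\<dots> = - (L r * (real r * (real r - 1) * \<alpha> / 2 + real r * \<theta>) *
                   (Gamma (\<theta> + real r * \<alpha>) / Gamma (\<theta> + (real r - 1) * \<alpha> + 1)) *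
                   (1 / real n powr \<alpha>))"
      unfolding as Lr[symmetric] mult_minus_left by (simp add: mult_ac)
    finally have "(\<Sum>j\<le>r. a j * (L j * p n j)) - (\<Sum>j<s. a j * (L j * p n j)) =
        L r * (1 - (real r * (real r - 1) * \<alpha> / 2 + real r * \<theta>) *
                   (Gamma (\<theta> + real r * \<alpha>) / Gamma (\<theta> + (real r - 1) * \<alpha> + 1)) *
                   (1 / real n powr \<alpha>))"
      unfolding right_diff_distrib by (simp add: mult.assoc)
    moreover have "(\<Sum>j\<le>r. a j * ((m n j / real n powr (real j * \<alpha>) - L j) * p n j)) =
        (\<Sum>j\<le>r. a j * (m n j / real n powr (real j * \<alpha>) * p n j)) - (\<Sum>j\<le>r. a j * (L j * p n j))"
      by (simp add: sum_subtractf left_diff_distrib right_diff_distrib)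
    ultimately show ?case unfolding E by (simp add: L_def t_def)
  qed
  ultimately show ?thesis unfolding g_def by (simp only: landau_o.big.in_cong)
qed

end
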